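(* Let $d\ge2$, let $v_0,\ldots,v_d\in\mathbb R^d$ be affinely independent, and let $S=[v_0,\ldots,v_d]$ be an orthocentric simplex with orthocenter $w$ such that $w\in\operatorname{relint}S$ or $w\in\operatorname{aff}S\setminus S$. Let $c\ne0$ be the number with $\langle v_i-w,v_j-w\rangle=c$ for all $0\le i\ne j\le d$ (it exists), and let $$\mu_i=\frac1{\|v_i-w\|^2-c},\qquad i=0,\ldots,d$$ (these numbers are well-defined). Let $k\in\{0,\ldots,d-1\}$ and $F:=[v_0,\ldots,v_k]$. (a) The tangent cone of $S$ at the face $F$ can be represented as a direct orthogonal sum $T(F,S)=L\oplus D$ of the $k$-dimensional lineality space $L$ of $F$ and a pointed cone $D$ isometric to $$C_{d-k}\Bigl(-\frac1c-\mu_{k+1}-\cdots-\mu_d;\ \mu_{k+1},\ldots,\mu_d;\ 1,\ldots,1\Bigr)=C_{d-k}(\mu_0+\cdots+\mu_k;\ \mu_{k+1},\ldots,\mu_d;\ 1,\ldots,1).$$ (b) The normal cone $N(F,S)$ of $S$ at $F$ is isometric to $$C_{d-k}\Bigl(\frac1c;\ \mu_{k+1},\ldots,\mu_d;\ \operatorname{sgn}(\mu_{k+1}),\ldots,\operatorname{sgn}(\mu_d)\Bigr)=C_{d-k}(-\mu_0-\cdots-\mu_d;\ \mu_{k+1},\ldots,\mu_d;\ \operatorname{sgn}(\mu_{k+1}),\ldots,\operatorname{sgn}(\mu_d)).$$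
   Context: $[\ldots]$ denotes the convex hull, $\operatorname{aff}$ the affine hull, $\operatorname{relint}$ the relative interior. For a $d$-simplex ($d\ge2$) with vertices $v_0,\ldots,v_d$, the altitude of $v_i$ is the line in $\operatorname{aff}(v_0,\ldots,v_d)$ through $v_i$ orthogonal to the affine hull of the remaining vertices. The simplex is orthocentric if all altitudes meet in a single point, called its orthocenter. For a face $F$ of a polytope $P\subseteq\mathbb R^d$ and $x_0$ in the relative interior of $F$, the tangent cone is $T(F,P)=\{v\in\mathbb R^d:x_0+\varepsilon v\in P\text{ for some }\varepsilon>0\}$ and the normal cone is its polar $N(F,P)=\{v\in\mathbb R^d:\langle v,z-x_0\rangle\le0\text{ for all }z\in P\}$. The "lineality space of $F$" is the linear subspace parallel to $\operatorname{aff}F$, which is the largest linear subspace contained in $T(F,P)$. A cone is pointed if it contains no line. Orthocentric cone: $C_m(\lambda_0;\lambda_1,\ldots,\lambda_m;\varepsilon_1,\ldots,\varepsilon_m):=\operatorname{pos}(\varepsilon_1u_1,\ldots,\varepsilon_mu_m)$ (positive hull), where $u_1,\ldots,u_m$ are linearly independent vectors in some $\mathbb R^N$, $N\ge m$, with $\langle u_i,u_j\rangle=\frac1{\lambda_0}+\frac{\delta_{ij}}{\lambda_i}$ for all $i,j$; here $\lambda_0,\ldots,\lambda_m\in\mathbb R\setminus\{0\}$ and $\varepsilon_i\in\{\pm1\}$. It is defined up to isometry, and exists exactly when either all $\lambda_0,\ldots,\lambda_m$ are positive, or exactly one of them is negative, all others are positive and $\lambda_0+\cdots+\lambda_m<0$.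 *)

theory Defs
  imports "HOL-Analysis.Analysis"
begin

definition altitude :: "(nat \<Rightarrow> 'a::euclidean_space) \<Rightarrow> nat \<Rightarrow> nat \<Rightarrow> 'a set" where
  "altitude v d i =
     {x \<in> affine hull (v ` {..d}).
        \<forall>y \<in> affine hull (v ` ({..d} - {i})). \<forall>z \<in> affine hull (v ` ({..d} - {i})).
          (x - v i) \<bullet> (y - z) = 0}"

text \<open>A simplex is orthocentric iff it has an orthocenter in the sense of the next definition.\<close>

definition is_orthocenter :: "(nat \<Rightarrow> 'a::euclidean_space) \<Rightarrow> nat \<Rightarrow> 'a \<Rightarrow> bool" where
  "is_orthocenter v d w \<longleftrightarrow> (\<Inter>i\<in>{..d}. altitude v d i) = {w}"

text \<open>
  Tangent and normal cones are taken at a point x0. For a face F of P the cones T(F,P) and N(F,P)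
  are the ones at any x0 in the relative interior of F; they do not depend on this choice.
\<close>

definition tangent_cone :: "'a::euclidean_space \<Rightarrow> 'a set \<Rightarrow> 'a set" where
  "tangent_cone x0 P = {v. \<exists>\<epsilon>>0. x0 + \<epsilon> *\<^sub>R v \<in> P}"

definition normal_cone :: "'a::euclidean_space \<Rightarrow> 'a set \<Rightarrow> 'a set" where
  "normal_cone x0 P = {v. \<forall>z\<in>P. v \<bullet> (z - x0) \<le> 0}"

definition lineality_space :: "'a::euclidean_space set \<Rightarrow> 'a set" where
  "lineality_space F = {x - y | x y. x \<in> affine hull F \<and> y \<in> affine hull F}"

definition pointed :: "'a::euclidean_space set \<Rightarrow> bool" where
  "pointed D \<longleftrightarrow> \<not> (\<exists>a b. b \<noteq> 0 \<and> (\<forall>t. a + t *\<^sub>R b \<in> D))"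

text \<open>
  Isometry of cones with apex 0, possibly lying in different spaces: a linear isometry of the
  linear spans that maps one cone onto the other.
\<close>

definition isometric_cones :: "'a::euclidean_space set \<Rightarrow> 'b::euclidean_space set \<Rightarrow> bool" where
  "isometric_cones A B \<longleftrightarrow>
     (\<exists>f. linear f \<and> (\<forall>x \<in> span A. norm (f x) = norm x) \<and> f ` A = B)"

text \<open>
  C is a representative of the orthocentric cone with the parameters l0; l 1, ..., l m;
  e 1, ..., e m. The values of l and e outside 1, ..., m are irrelevant.
\<close>

definition orthocentric_cone ::
  "nat \<Rightarrow> real \<Rightarrow> (nat \<Rightarrow> real) \<Rightarrow> (nat \<Rightarrow> real) \<Rightarrow> 'b::euclidean_space set \<Rightarrow> bool" where
  "orthocentric_cone m l0 l e C \<longleftrightarrow>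
     l0 \<noteq> 0 \<and> (\<forall>i\<in>{1..m}. l i \<noteq> 0 \<and> (e i = 1 \<or> e i = -1)) \<and>
     (\<exists>u. inj_on u {1..m} \<and> independent (u ` {1..m}) \<and>
        (\<forall>i\<in>{1..m}. \<forall>j\<in>{1..m}. u i \<bullet> u j = 1 / l0 + (if i = j then 1 / l i else 0)) \<and>
        C = convex_cone hull ((\<lambda>i. e i *\<^sub>R u i) ` {1..m}))"

text \<open>
  The orthocentric cone is defined only up to isometry. Being isometric to it means that
  representatives exist in the Euclidean space 'b, and that D is isometric to each of them.
\<close>

definition isometric_to_orthocentric_cone ::
  "'b::euclidean_space itself \<Rightarrow> 'a::euclidean_space set \<Rightarrow>
     nat \<Rightarrow> real \<Rightarrow> (nat \<Rightarrow> real) \<Rightarrow> (nat \<Rightarrow> real) \<Rightarrow> bool" where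
  "isometric_to_orthocentric_cone (_ :: 'b itself) D m l0 l e \<longleftrightarrow>
     (\<exists>C :: 'b set. orthocentric_cone m l0 l e C) \<and>
     (\<forall>C :: 'b set. orthocentric_cone m l0 l e C \<longrightarrow> isometric_cones D C)"

end

theory Submission
  imports Defs
begin

text \<open>
  Put p i = v i - w. Since the p i span the space, the sum of the \<mu> i p i is 0 and the sum of the \<mu> i
  is -1/c. So the affine functions \<mu> i (\<langle>x - w, p i\<rangle> - c) are the barycentric coordinates of x, and
  they cut out S. Let q be the mean of p 0, ..., p k with weights \<mu> i. The vectors u j = p j - q and
  \<mu> j p j, for j > k, form dual bases of the orthogonal complement of the lineality space of F. Hence
  the pointed part of the tangent cone is spanned by the u j and the normal cone by the
  -sgn (\<mu> j) p j, and the Gram matrices of the u j and of the -p j are those of the two orthocentric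
  cones. If c were 0, orthogonality of d + 1 vectors would make w a vertex of S.
\<close>

subsection \<open>Orthocentric cones up to isometry\<close>

text \<open>Polarization: the norms of x, y and x + y determine the inner product of x and
  y.\<close>

lemma linear_isometry_inner_eq:
  fixes f :: "'a::real_inner \<Rightarrow> 'b::real_inner"
  assumes "linear f" "subspace V" "\<And>x. x \<in> V \<Longrightarrow> norm (f x) = norm x" "x \<in> V" "y \<in> V"
  shows "f x \<bullet> f y = x \<bullet> y"
proof -
  have "norm (f x + f y) = norm (x + y)"
    using assms by (metis linear_add subspace_add)
  then have "(norm (f x + f y))\<^sup>2 = (norm (x + y))\<^sup>2" by simp
  moreover have "norm (f x) = norm x" "norm (f y) = norm y" using assms by auto
  ultimately show ?thesis
    unfolding power2_norm_eq_inner norm_eq by (simp add: inner_simps inner_commute)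
qed

text \<open>By bilinearity, agreement of the Gram matrices on \<open>B\<close> extends to
  \<open>span B\<close>, one argument at a time.\<close>

lemma norm_preserving_if_gram_eq:
  fixes f :: "'a::real_inner \<Rightarrow> 'b::real_inner"
  assumes f: "linear f" and x: "x \<in> span B"
    and gram: "\<And>a b. a \<in> B \<Longrightarrow> b \<in> B \<Longrightarrow> f a \<bullet> f b = a \<bullet> b"
  shows "norm (f x) = norm x"
proof -
  have B: "f a \<bullet> f y = a \<bullet> y" if "a \<in> B" "y \<in> span B" for a y
    using that(2)
  proof (induction rule: span_induct_alt)
    case base
    then show ?case by (simp add: linear_0[OF f])
  next
    case (step r b y)
    then show ?case
      using gram[OF that(1), of b] by (simp add: linear_add[OF f] linear_cmul[OF f] inner_simps)
  qed
  have "f y \<bullet> f z = y \<bullet> z" if "y \<in> span B" "z \<in> span B" for y z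
    using that(1)
  proof (induction rule: span_induct_alt)
    case base
    then show ?case by (simp add: linear_0[OF f])
  next
    case (step r b y)
    then show ?case
      using B[of b z] that(2) by (simp add: linear_add[OF f] linear_cmul[OF f] inner_simps)
  qed
  then show ?thesis
    using x by (simp add: norm_eq)
qed

text \<open>It suffices that \<open>D\<close> is itself a representative in its own space. A copy in
  the other space is obtained from an isometric embedding of the span of the generators, and any two
  representatives are isometric because their generators have the same Gram matrix.\<close>

lemma isometric_to_orthocentric_cone_self:
  fixes D :: "'a::euclidean_space set"
  assumes D: "orthocentric_cone m l0 l e D" and dim: "DIM('b::euclidean_space) \<ge> m"
  shows "isometric_to_orthocentric_cone TYPE('b) D m l0 l e"
proof -
  obtain u where u: "inj_on u {1..m}" "independent (u ` {1..m})"
    "\<forall>i\<in>{1..m}. \<forall>j\<in>{1..m}. u i \<bullet> u j = 1 / l0 + (if i = j then 1 / l i else 0)"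
    "D = convex_cone hull ((\<lambda>i. e i *\<^sub>R u i) ` {1..m})"
    and l: "l0 \<noteq> 0" "\<forall>i\<in>{1..m}. l i \<noteq> 0 \<and> (e i = 1 \<or> e i = -1)"
    using D unfolding orthocentric_cone_def by blast
  have span_D: "span D \<subseteq> span (u ` {1..m})"
  proof -
    have "(\<lambda>i. e i *\<^sub>R u i) ` {1..m} \<subseteq> span (u ` {1..m})"
      by (auto intro: span_mul[OF span_base])
    then show ?thesis
      unfolding u(4) by (intro span_minimal hull_minimal convex_cone_span subspace_span)
  qed
  have image_D: "f ` D = convex_cone hull ((\<lambda>i. e i *\<^sub>R f (u i)) ` {1..m})" if "linear f"
    for f :: "'a \<Rightarrow> 'b"
    unfolding u(4) convex_cone_hull_linear_image[OF that, symmetric]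
    by (simp add: image_image linear_cmul[OF that])
  \<comment> \<open>The m generators span an m-dimensional space, which fits into the target space
    by \<open>dim\<close>.\<close>
  have "dim (span (u ` {1..m})) \<le> dim (UNIV :: 'b set)"
    using dim u(1,2) by (simp add: dim_eq_card_independent card_image)
  then have "\<exists>f :: 'a \<Rightarrow> 'b. linear f \<and> (\<forall>x\<in>span (u ` {1..m}). norm (f x) = norm x)"
    by (rule isometry_subset_subspace[OF subspace_span subspace_UNIV]) auto
  then obtain f :: "'a \<Rightarrow> 'b" where f: "linear f"
    "\<And>x. x \<in> span (u ` {1..m}) \<Longrightarrow> norm (f x) = norm x"
    by blast
  have inj: "inj_on f (span (u ` {1..m}))"
  proof (rule inj_onI)
    fix x y assume "x \<in> span (u ` {1..m})" "y \<in> span (u ` {1..m})" "f x = f y"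
    then show "x = y"
      using f(2)[of "x - y"] linear_diff[OF f(1), of x y] by (simp add: span_diff)
  qed
  have "orthocentric_cone m l0 l e (f ` D)"
    unfolding orthocentric_cone_def
  proof (intro conjI exI[of _ "\<lambda>i. f (u i)"])
    show "inj_on (\<lambda>i. f (u i)) {1..m}"
      using comp_inj_on[OF u(1) inj_on_subset[OF inj span_superset]] by (simp add: comp_def)
    have "independent (f ` (u ` {1..m}))"
      using u(2) inj f(1) linear_independent_injective_image by blast
    then show "independent ((\<lambda>i. f (u i)) ` {1..m})"
      by (simp add: image_image)
    show "\<forall>i\<in>{1..m}. \<forall>j\<in>{1..m}. f (u i) \<bullet> f (u j) = 1 / l0 + (if i = j then 1 / l i else 0)"
      using linear_isometry_inner_eq[OF f(1) subspace_span f(2)] u(3) by (simp add: span_base)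
  qed (use l image_D[OF f(1)] in auto)
  moreover have "isometric_cones D C" if C: "orthocentric_cone m l0 l e C" for C :: "'b set"
  proof -
    obtain u' where u': 
      "\<forall>i\<in>{1..m}. \<forall>j\<in>{1..m}. u' i \<bullet> u' j = 1 / l0 + (if i = j then 1 / l i else 0)"
      "C = convex_cone hull ((\<lambda>i. e i *\<^sub>R u' i) ` {1..m})"
      using C unfolding orthocentric_cone_def by blast
    \<comment> \<open>The map sending each \<open>u i\<close> to \<open>u' i\<close> is well defined
      by injectivity of \<open>u\<close>, and independence extends it linearly.\<close>
    obtain g where g: "linear g" "\<forall>x\<in>u ` {1..m}. g x = u' (inv_into {1..m} u x)"
      using linear_independent_extend[OF u(2), of "\<lambda>x. u' (inv_into {1..m} u x)"]
      by (elim exE conjE)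
    have gu: "g (u i) = u' i" if "i \<in> {1..m}" for i
      using bspec[OF g(2), of "u i"] that u(1) by simp
    have "norm (g x) = norm x" if "x \<in> span D" for x
    proof (rule norm_preserving_if_gram_eq[OF g(1)])
      show "x \<in> span (u ` {1..m})"
        using span_D that by blast
      fix a b assume "a \<in> u ` {1..m}" "b \<in> u ` {1..m}"
      then obtain i j where "i \<in> {1..m}" "a = u i" "j \<in> {1..m}" "b = u j" by blast
      then show "g a \<bullet> g b = a \<bullet> b"
        using u(3) u'(1) by (simp add: gu)
    qed
    moreover have "g ` D = C"
      unfolding image_D[OF g(1)] u'(2) by (simp add: gu)
    ultimately show ?thesis
      using g(1) unfolding isometric_cones_def by blast
  qed
  ultimately show ?thesis
    unfolding isometric_to_orthocentric_cone_def by blast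
qed

subsection \<open>Cones spanned by one of two dual bases\<close>

lemma sum_in_convex_cone:
  assumes "convex_cone C" "\<And>i. i \<in> I \<Longrightarrow> f i \<in> C"
  shows "sum f I \<in> C"
  using assms by (induction I rule: infinite_finite_induct) (auto simp: convex_cone_iff)

text \<open>Pairing a vanishing linear combination of the \<open>a i\<close> with \<open>b j\<close>
  isolates the coefficient of \<open>a j\<close>.\<close>

lemma biorthogonal_independent:
  fixes a b :: "'i \<Rightarrow> 'a::euclidean_space"
  assumes I: "finite I" and ab: "\<And>i j. i \<in> I \<Longrightarrow> j \<in> I \<Longrightarrow> a i \<bullet> b j = (if i = j then 1 else 0)"
  shows "inj_on a I" "independent (a ` I)"
proof -
  show inj: "inj_on a I"
  proof (rule inj_onI, rule ccontr)
    fix i j assume "i \<in> I" "j \<in> I" "a i = a j" "i \<noteq> j"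
    then show False
      using ab[of i i] ab[of j i] by simp
  qed
  show "independent (a ` I)"
  proof (rule independent_if_scalars_zero)
    fix f x assume 0: "(\<Sum>x\<in>a ` I. f x *\<^sub>R x) = 0" and "x \<in> a ` I"
    then obtain j where j: "j \<in> I" "x = a j" by blast
    have "(\<Sum>i\<in>I. f (a i) * (a i \<bullet> b j)) = 0"
      using arg_cong[OF 0, of "\<lambda>x. x \<bullet> b j"] by (simp add: sum.reindex[OF inj] inner_sum_left)
    moreover have "(\<Sum>i\<in>I. f (a i) * (a i \<bullet> b j)) = (\<Sum>i\<in>I. if i = j then f (a i) else 0)"
      using j by (intro sum.cong) (auto simp: ab)
    ultimately show "f x = 0"
      using I j by simp
  qed (use I in simp)
qed

text \<open>The difference of the two sides lies in \<open>W\<close> and is orthogonal to every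
  \<open>b j\<close>. The assumption \<open>total\<close> takes the place of a dimension
  count.\<close>

lemma biorthogonal_expansion:
  fixes a b :: "'i \<Rightarrow> 'a::euclidean_space"
  assumes I: "finite I" and ab: "\<And>i j. i \<in> I \<Longrightarrow> j \<in> I \<Longrightarrow> a i \<bullet> b j = (if i = j then 1 else 0)"
    and W: "subspace W" "\<And>i. i \<in> I \<Longrightarrow> a i \<in> W"
    and total: "\<And>x. x \<in> W \<Longrightarrow> (\<And>i. i \<in> I \<Longrightarrow> x \<bullet> b i = 0) \<Longrightarrow> x = 0" and x: "x \<in> W"
  shows "x = (\<Sum>i\<in>I. (x \<bullet> b i) *\<^sub>R a i)"
proof -
  have "x - (\<Sum>i\<in>I. (x \<bullet> b i) *\<^sub>R a i) = 0"
  proof (rule total)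
    show "x - (\<Sum>i\<in>I. (x \<bullet> b i) *\<^sub>R a i) \<in> W"
      using W x by (intro subspace_diff subspace_sum subspace_mul) auto
    fix j assume j: "j \<in> I"
    have "(\<Sum>i\<in>I. (x \<bullet> b i) * (a i \<bullet> b j)) = (\<Sum>i\<in>I. if i = j then x \<bullet> b i else 0)"
      using j by (intro sum.cong) (auto simp: ab)
    then show "(x - (\<Sum>i\<in>I. (x \<bullet> b i) *\<^sub>R a i)) \<bullet> b j = 0"
      using I j by (simp add: inner_diff_left inner_sum_left)
  qed
  then show ?thesis by simp
qed

text \<open>The numbers \<open>x \<bullet> b i\<close> are the coordinates of x in the basis
  \<open>a\<close>, so the cone consists of the vectors with nonnegative coordinates.\<close>

lemma biorthogonal_convex_cone_hull:
  fixes a b :: "'i \<Rightarrow> 'a::euclidean_space"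
  assumes I: "finite I" and ab: "\<And>i j. i \<in> I \<Longrightarrow> j \<in> I \<Longrightarrow> a i \<bullet> b j = (if i = j then 1 else 0)"
    and W: "subspace W" "\<And>i. i \<in> I \<Longrightarrow> a i \<in> W"
    and total: "\<And>x. x \<in> W \<Longrightarrow> (\<And>i. i \<in> I \<Longrightarrow> x \<bullet> b i = 0) \<Longrightarrow> x = 0"
  shows "convex_cone hull (a ` I) = {x \<in> W. \<forall>i\<in>I. 0 \<le> x \<bullet> b i}"
proof
  show "convex_cone hull (a ` I) \<subseteq> {x \<in> W. \<forall>i\<in>I. 0 \<le> x \<bullet> b i}"
  proof (rule hull_minimal)
    show "convex_cone {x \<in> W. \<forall>i\<in>I. 0 \<le> x \<bullet> b i}"
      using W(1) by (auto simp: convex_cone_iff subspace_def inner_add_left)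
  qed (use ab W in auto)
  show "{x \<in> W. \<forall>i\<in>I. 0 \<le> x \<bullet> b i} \<subseteq> convex_cone hull (a ` I)"
  proof safe
    fix x assume x: "x \<in> W" "\<forall>i\<in>I. 0 \<le> x \<bullet> b i"
    have "(\<Sum>i\<in>I. (x \<bullet> b i) *\<^sub>R a i) \<in> convex_cone hull (a ` I)"
      using x(2) by (intro sum_in_convex_cone convex_cone_convex_cone_hull convex_cone_hull_mul hull_inc) auto
    moreover have "x = (\<Sum>i\<in>I. (x \<bullet> b i) *\<^sub>R a i)"
      by (rule biorthogonal_expansion[OF I ab W total x(1)])
    ultimately show "x \<in> convex_cone hull (a ` I)" by metis
  qed
qed

subsection \<open>Orthocentric simplices\<close>

text \<open>Orthogonality of the altitude through \<open>v i\<close> to the opposite facet makes row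
  i of the Gram matrix constant off the diagonal. Symmetry of the matrix then links the
  rows.\<close>

lemma orthocenter_inner_eq:
  assumes w: "is_orthocenter v d w" and d: "d \<ge> 2"
  shows "\<exists>c. \<forall>i\<le>d. \<forall>j\<le>d. i \<noteq> j \<longrightarrow> (v i - w) \<bullet> (v j - w) = c"
proof -
  have orth: "(w - v i) \<bullet> (v j - v l) = 0" if "i \<le> d" "j \<le> d" "l \<le> d" "j \<noteq> i" "l \<noteq> i" for i j l
  proof -
    have "w \<in> altitude v d i"
      using w that unfolding is_orthocenter_def by blast
    moreover have "v j \<in> affine hull (v ` ({..d} - {i}))" "v l \<in> affine hull (v ` ({..d} - {i}))"
      using that by (auto intro!: hull_inc)
    ultimately show ?thesis
      unfolding altitude_def by blast
  qed
  define g where "g i j = (v i - w) \<bullet> (v j - w)" for i j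
  have comm: "g i j = g j i" for i j
    by (simp add: g_def inner_commute)
  have right: "g i j = g i l" if "i \<le> d" "j \<le> d" "l \<le> d" "j \<noteq> i" "l \<noteq> i" for i j l
    using orth[OF that] by (simp add: g_def algebra_simps inner_simps)
  have "g i j = g 0 1" if "i \<le> d" "j \<le> d" "i \<noteq> j" for i j
  proof (cases "i = 0")
    case True
    then show ?thesis using right[of 0 j 1] that d by simp
  next
    case False
    then have "g i j = g 0 i" using right[of i j 0] that comm[of i 0] by simp
    then show ?thesis using right[of 0 i 1] that False d by simp
  qed
  then show ?thesis unfolding g_def by blast
qed

text \<open>The position of \<open>w\<close> relative to the simplex enters only through
  \<open>c_nonzero\<close>.\<close>

locale orthocentric_simplex =
  fixes v :: "nat \<Rightarrow> 'a::euclidean_space" and d :: nat and w :: 'a and c :: real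
  assumes c_nonzero: "c \<noteq> 0"
    and affine_hull_UNIV: "affine hull (v ` {..d}) = UNIV"
    and inner_eq: "\<And>i j. i \<le> d \<Longrightarrow> j \<le> d \<Longrightarrow> i \<noteq> j \<Longrightarrow> (v i - w) \<bullet> (v j - w) = c"
begin

definition p :: "nat \<Rightarrow> 'a" where
  "p i = v i - w"

definition \<mu> :: "nat \<Rightarrow> real" where
  "\<mu> i = 1 / ((norm (v i - w))\<^sup>2 - c)"

text \<open>The bracket vanishes at every \<open>v j\<close> with j different from i, since the
  inner product there is c. The factor \<open>\<mu> i\<close> normalizes the value at
  \<open>v i\<close> to 1.\<close>

definition bary :: "nat \<Rightarrow> 'a \<Rightarrow> real" where
  "bary i x = \<mu> i * ((x - w) \<bullet> p i - c)"

lemma vertex_diff_eq: "v i - v j = p i - p j"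
  by (simp add: p_def)

text \<open>If x were nonzero, all vertices would lie in one hyperplane normal to x, although their
  affine hull is the whole space. This is the standard way below to show that a vector is
  zero.\<close>

lemma eq_0_if_orthogonal_diffs:
  assumes "\<And>i. i \<le> d \<Longrightarrow> x \<bullet> p i = x \<bullet> p 0"
  shows "x = 0"
proof -
  have "v ` {..d} \<subseteq> {y. x \<bullet> y = x \<bullet> v 0}"
  proof safe
    fix i assume "i \<le> d"
    from assms[OF this] show "x \<bullet> v i = x \<bullet> v 0"
      by (simp add: p_def inner_diff_right)
  qed
  then have "affine hull (v ` {..d}) \<subseteq> {y. x \<bullet> y = x \<bullet> v 0}"
    by (intro hull_minimal affine_hyperplane)
  then have "v 0 + x \<in> {y. x \<bullet> y = x \<bullet> v 0}"
    using affine_hull_UNIV by blast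
  then show ?thesis by (simp add: inner_simps)
qed

text \<open>Otherwise \<open>p i\<close> has inner product c with every \<open>p j\<close>, itself
  included. Then \<open>p i\<close> is 0, and so is c.\<close>

lemma norm_nonzero:
  assumes "i \<le> d"
  shows "(norm (v i - w))\<^sup>2 - c \<noteq> 0"
proof
  assume *: "(norm (v i - w))\<^sup>2 - c = 0"
  then have "p i \<bullet> p j = c" if "j \<le> d" for j
    using inner_eq[OF assms that] by (cases "i = j") (auto simp: p_def power2_norm_eq_inner)
  then have "p i = 0"
    by (intro eq_0_if_orthogonal_diffs) simp
  then show False
    using * c_nonzero by (simp add: p_def)
qed

lemma \<mu>_nonzero: "i \<le> d \<Longrightarrow> \<mu> i \<noteq> 0"
  using norm_nonzero by (simp add: \<mu>_def)

lemma inner_p: "i \<le> d \<Longrightarrow> j \<le> d \<Longrightarrow> p i \<bullet> p j = c + (if i = j then 1 / \<mu> i else 0)"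
  using inner_eq[of i j] by (auto simp: p_def \<mu>_def power2_norm_eq_inner)

lemma inner_sum_p:
  assumes "A \<subseteq> {..d}" "j \<le> d"
  shows "(\<Sum>i\<in>A. a i *\<^sub>R p i) \<bullet> p j = c * sum a A + (if j \<in> A then a j / \<mu> j else 0)"
proof -
  have "finite A" using assms(1) finite_subset by blast
  have "(\<Sum>i\<in>A. a i *\<^sub>R p i) \<bullet> p j = (\<Sum>i\<in>A. c * a i + (if i = j then a j / \<mu> j else 0))"
    using assms by (simp add: inner_sum_left) (intro sum.cong, auto simp: inner_p algebra_simps)
  also have "\<dots> = c * sum a A + (if j \<in> A then a j / \<mu> j else 0)"
    using \<open>finite A\<close> by (simp add: sum.distrib sum_distrib_left)
  finally show ?thesis .
qed

text \<open>By \<open>inner_sum_p\<close> the inner product of the sum with \<open>p j\<close> is c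
  times the sum of the \<open>\<mu> i\<close>, plus 1, whatever j is.\<close>

lemma sum_\<mu>_p: "(\<Sum>i\<le>d. \<mu> i *\<^sub>R p i) = 0"
  by (rule eq_0_if_orthogonal_diffs) (simp add: inner_sum_p \<mu>_nonzero)

text \<open>That common inner product must be 0, because the vector is 0.\<close>

lemma sum_\<mu>: "1 / c = - (\<Sum>i\<le>d. \<mu> i)"
  using inner_sum_p[of "{..d}" 0 \<mu>] c_nonzero \<mu>_nonzero[of 0]
  by (simp add: sum_\<mu>_p field_simps)

lemma sum_bary: "(\<Sum>i\<le>d. bary i x) = 1"
proof -
  have "(\<Sum>i\<le>d. bary i x) = (x - w) \<bullet> (\<Sum>i\<le>d. \<mu> i *\<^sub>R p i) - c * (\<Sum>i\<le>d. \<mu> i)"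
    by (simp add: bary_def inner_sum_right sum_distrib_left right_diff_distrib sum_subtractf mult.commute)
  also have "\<dots> = 1"
    using sum_\<mu> c_nonzero by (simp add: sum_\<mu>_p field_simps)
  finally show ?thesis .
qed

text \<open>Both sides have the same inner product with every \<open>p j\<close>, because the
  coordinates sum to 1.\<close>

lemma bary_p: "x - w = (\<Sum>i\<le>d. bary i x *\<^sub>R p i)"
proof -
  have "(\<Sum>i\<le>d. bary i x *\<^sub>R p i) \<bullet> p j = (x - w) \<bullet> p j" if "j \<le> d" for j
    using that \<mu>_nonzero[OF that] by (simp add: inner_sum_p sum_bary) (simp add: bary_def)
  then have "(\<Sum>i\<le>d. bary i x *\<^sub>R p i) - (x - w) = 0"
    by (intro eq_0_if_orthogonal_diffs) (simp add: inner_diff_left)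
  then show ?thesis by simp
qed

lemma sum_v: "sum b A = 1 \<Longrightarrow> (\<Sum>i\<in>A. b i *\<^sub>R v i) = w + (\<Sum>i\<in>A. b i *\<^sub>R p i)"
  by (simp add: p_def scaleR_diff_right sum_subtractf flip: scaleR_sum_left)

lemma bary_v: "(\<Sum>i\<le>d. bary i x *\<^sub>R v i) = x"
  by (simp add: sum_v[OF sum_bary] flip: bary_p)

text \<open>Uniqueness of barycentric coordinates, read off from the Gram matrix; existence is
  \<open>bary_v\<close>.\<close>

lemma bary_sum_v:
  assumes "A \<subseteq> {..d}" "sum b A = 1" "j \<le> d"
  shows "bary j (\<Sum>i\<in>A. b i *\<^sub>R v i) = (if j \<in> A then b j else 0)"
  using assms \<mu>_nonzero[of j] by (simp add: sum_v bary_def inner_sum_p)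

lemma bary_vertex:
  assumes "i \<le> d" "j \<le> d"
  shows "bary j (v i) = (if j = i then 1 else 0)"
  using bary_sum_v[of "{i}" "\<lambda>_. 1" j] assms by simp

lemma bary_add: "bary i (x + t *\<^sub>R y) = bary i x + t * (\<mu> i * (y \<bullet> p i))"
proof -
  have "x + t *\<^sub>R y - w = (x - w) + t *\<^sub>R y" by simp
  then show ?thesis
    unfolding bary_def by (simp only: inner_add_left inner_scaleR_left) (simp add: algebra_simps)
qed

text \<open>The right-hand side is an intersection of half-spaces containing the vertices.
  Conversely, nonnegative coordinates exhibit x as a convex combination by \<open>bary_v\<close> and
  \<open>sum_bary\<close>.\<close>

lemma convex_hull_eq: "convex hull (v ` {..d}) = {x. \<forall>i\<le>d. 0 \<le> bary i x}"
proof
  have "(0 \<le> bary i x) = (\<mu> i * (w \<bullet> p i + c) \<le> (\<mu> i *\<^sub>R p i) \<bullet> x)" for i x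
    unfolding bary_def inner_diff_left inner_scaleR_left inner_commute[of "p i" x] right_diff_distrib distrib_left
    by linarith
  then have "convex {x. 0 \<le> bary i x}" for i
    by (simp only: convex_halfspace_ge)
  then have "convex (\<Inter>i\<in>{..d}. {x. 0 \<le> bary i x})"
    by (intro convex_INT) simp
  moreover have "{x. \<forall>i\<le>d. 0 \<le> bary i x} = (\<Inter>i\<in>{..d}. {x. 0 \<le> bary i x})"
    by auto
  ultimately have "convex {x. \<forall>i\<le>d. 0 \<le> bary i x}"
    by simp
  then show "convex hull (v ` {..d}) \<subseteq> {x. \<forall>i\<le>d. 0 \<le> bary i x}"
    by (intro hull_minimal) (auto simp: bary_vertex)
  show "{x. \<forall>i\<le>d. 0 \<le> bary i x} \<subseteq> convex hull (v ` {..d})"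
  proof safe
    fix x assume "\<forall>i\<le>d. 0 \<le> bary i x"
    then have "(\<Sum>i\<le>d. bary i x *\<^sub>R v i) \<in> convex hull (v ` {..d})"
      by (intro convex_sum sum_bary convex_convex_hull) (auto intro: hull_inc)
    then show "x \<in> convex hull (v ` {..d})" by (simp add: bary_v)
  qed
qed

end

subsection \<open>Tangent and normal cones at a face\<close>

text \<open>The translate of the affine hull by a point of it is a subspace, hence closed under
  differences.\<close>

lemma lineality_space_eq_translation:
  assumes a: "a \<in> affine hull A"
  shows "lineality_space A = (\<lambda>x. x - a) ` (affine hull A)"
proof
  have sub: "subspace ((\<lambda>x. x - a) ` (affine hull A))"
    using a by (intro affine_diffs_subspace_subtract affine_affine_hull)
  show "lineality_space A \<subseteq> (\<lambda>x. x - a) ` (affine hull A)"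
  proof
    fix x assume "x \<in> lineality_space A"
    then obtain y z where yz: "y \<in> affine hull A" "z \<in> affine hull A" and x: "x = (y - a) - (z - a)"
      unfolding lineality_space_def by auto
    show "x \<in> (\<lambda>x. x - a) ` (affine hull A)"
      unfolding x using yz by (intro subspace_diff[OF sub] imageI)
  qed
  show "(\<lambda>x. x - a) ` (affine hull A) \<subseteq> lineality_space A"
    using a unfolding lineality_space_def by blast
qed

lemma aff_dim_eq_dim_lineality_space:
  fixes A :: "'a::euclidean_space set"
  assumes "A \<noteq> {}"
  shows "aff_dim A = int (dim (lineality_space A))"
proof -
  obtain a where a: "a \<in> affine hull A"
    using assms hull_subset[of A affine] by blast
  then have "aff_dim (affine hull A) = int (dim (lineality_space A))"
    unfolding lineality_space_eq_translation[OF a] by (intro aff_dim_eq_dim_subtract) simp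
  then show ?thesis by simp
qed

section \<open>The projection of the orthocenter onto the face, and dual bases\<close>

locale orthocentric_simplex_face = orthocentric_simplex +
  fixes k :: nat
  assumes k_less: "k < d"
begin

text \<open>The orthogonal complement of the lineality space of the face, see
  \<open>face_orth_iff\<close>. In this form, membership says that \<open>y \<bullet> p i\<close> is
  constant over i \<le> k.\<close>

definition face_orth :: "'a set" where
  "face_orth = {y. \<forall>i\<le>k. y \<bullet> (p i - p 0) = 0}"

definition \<mu>_face :: real where
  "\<mu>_face = (\<Sum>i\<le>k. \<mu> i)"

text \<open>The point \<open>w + q\<close> is the orthogonal projection of \<open>w\<close> onto the
  affine hull of the face: the weights sum to 1, and by \<open>inner_q_p\<close> the vector q has
  equal inner products with all \<open>p i\<close>, i \<le> k.\<close>

definition q :: 'a where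
  "q = (1 / \<mu>_face) *\<^sub>R (\<Sum>i\<le>k. \<mu> i *\<^sub>R p i)"

definition u :: "nat \<Rightarrow> 'a" where
  "u i = p i - q"

lemma subspace_face_orth: "subspace face_orth"
  by (auto simp: face_orth_def subspace_def inner_add_left)

lemma face_orth_I:
  assumes "\<And>i. i \<le> k \<Longrightarrow> y \<bullet> p i = y \<bullet> p 0"
  shows "y \<in> face_orth"
  unfolding face_orth_def mem_Collect_eq inner_diff_right
proof (intro allI impI)
  fix i assume "i \<le> k"
  from assms[OF this] show "y \<bullet> p i - y \<bullet> p 0 = 0" by simp
qed

lemma face_orth_D:
  assumes "y \<in> face_orth" "i \<le> k"
  shows "y \<bullet> p i = y \<bullet> p 0"
proof -
  have "y \<bullet> (p i - p 0) = 0"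
    using assms unfolding face_orth_def by blast
  then show ?thesis by (simp add: inner_diff_right)
qed

text \<open>If the weights summed to 0, the vector x below would have inner product 1 with every
  \<open>p i\<close> of the face. Then \<open>x \<bullet> x\<close> would be the sum of the weights,
  so x would be 0, a contradiction.\<close>

lemma \<mu>_face_nonzero: "\<mu>_face \<noteq> 0"
proof
  assume \<mu>_face: "\<mu>_face = 0"
  define x where "x = (\<Sum>i\<le>k. \<mu> i *\<^sub>R p i)"
  have x: "x \<bullet> p i = 1" if "i \<le> k" for i
    using inner_sum_p[of "{..k}" i \<mu>] that k_less \<mu>_face \<mu>_nonzero[of i] by (simp add: x_def \<mu>_face_def)
  have "x \<bullet> x = (\<Sum>i\<le>k. \<mu> i * (x \<bullet> p i))"
    by (subst (2) x_def) (simp add: inner_sum_right)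
  also have "\<dots> = 0"
    using \<mu>_face by (simp add: x \<mu>_face_def)
  finally show False
    using x[of 0] by simp
qed

lemma inner_q_p:
  assumes "i \<le> d"
  shows "q \<bullet> p i = c + (if i \<le> k then 1 / \<mu>_face else 0)"
proof -
  have "q \<bullet> p i = (1 / \<mu>_face) * (c * \<mu>_face + (if i \<le> k then 1 else 0))"
    using inner_sum_p[of "{..k}" i \<mu>] assms k_less \<mu>_nonzero[OF assms]
    by (simp add: q_def flip: \<mu>_face_def)
  then show ?thesis
    using \<mu>_face_nonzero by (simp add: distrib_left)
qed

lemma inner_q_q: "q \<bullet> q = c + 1 / \<mu>_face"
proof -
  have "q \<bullet> q = (1 / \<mu>_face) * (\<Sum>i\<le>k. \<mu> i * (q \<bullet> p i))"
    by (subst (2) q_def) (simp add: inner_sum_right)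
  also have "(\<Sum>i\<le>k. \<mu> i * (q \<bullet> p i)) = (\<Sum>i\<le>k. \<mu> i * (c + 1 / \<mu>_face))"
    using k_less by (intro sum.cong) (auto simp: inner_q_p)
  also have "\<dots> = \<mu>_face * (c + 1 / \<mu>_face)"
    by (simp only: \<mu>_face_def sum_distrib_right)
  finally show ?thesis
    using \<mu>_face_nonzero by simp
qed

lemma inner_q_face_orth:
  assumes "y \<in> face_orth"
  shows "y \<bullet> q = y \<bullet> p 0"
proof -
  have "y \<bullet> (\<Sum>i\<le>k. \<mu> i *\<^sub>R p i) = (\<Sum>i\<le>k. \<mu> i * (y \<bullet> p 0))"
    unfolding inner_sum_right
  proof (rule sum.cong)
    fix i assume "i \<in> {..k}"
    then have "y \<bullet> p i = y \<bullet> p 0" using face_orth_D[OF assms] by blast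
    then show "y \<bullet> \<mu> i *\<^sub>R p i = \<mu> i * (y \<bullet> p 0)" by simp
  qed simp
  also have "\<dots> = \<mu>_face * (y \<bullet> p 0)"
    by (simp only: \<mu>_face_def sum_distrib_right)
  finally show ?thesis
    using \<mu>_face_nonzero by (simp add: q_def)
qed

lemma inner_u_p:
  assumes "i \<in> {k<..d}" "j \<le> d"
  shows "u i \<bullet> p j = (if i = j then 1 / \<mu> i else if j \<le> k then - 1 / \<mu>_face else 0)"
  using assms by (auto simp: u_def inner_diff_left inner_p inner_q_p)

text \<open>Subtracting q cancels c from the Gram matrix of the \<open>p i\<close> and leaves the
  one of the tangential cone, with \<lambda>_0 equal to \<open>\<mu>_face\<close>.\<close>

lemma inner_u_u:
  assumes "i \<in> {k<..d}" "j \<in> {k<..d}"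
  shows "u i \<bullet> u j = 1 / \<mu>_face + (if i = j then 1 / \<mu> i else 0)"
  using assms
  by (simp add: u_def inner_diff_left inner_diff_right inner_commute[of "p _" q] inner_p inner_q_p inner_q_q)

lemma p_in_face_orth: "i \<in> {k<..d} \<Longrightarrow> p i \<in> face_orth"
  using k_less by (intro face_orth_I) (auto simp: inner_p)

lemma u_in_face_orth: "i \<in> {k<..d} \<Longrightarrow> u i \<in> face_orth"
  using k_less by (intro face_orth_I) (auto simp: inner_u_p)

lemma inner_u_dual:
  assumes "i \<in> {k<..d}" "j \<in> {k<..d}"
  shows "u i \<bullet> (\<mu> j *\<^sub>R p j) = (if i = j then 1 else 0)"
  using assms \<mu>_nonzero[of j] by (simp add: inner_u_p)

text \<open>On \<open>face_orth\<close> the inner product with q equals that with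
  \<open>p 0\<close>. So orthogonality to the \<open>u i\<close> makes the inner products with all
  \<open>p i\<close> equal, also for i > k.\<close>

lemma u_total:
  assumes "x \<in> face_orth" "\<And>i. i \<in> {k<..d} \<Longrightarrow> x \<bullet> u i = 0"
  shows "x = 0"
proof (rule eq_0_if_orthogonal_diffs)
  fix i assume "i \<le> d"
  show "x \<bullet> p i = x \<bullet> p 0"
  proof (cases "i \<le> k")
    case True
    then show ?thesis by (rule face_orth_D[OF assms(1)])
  next
    case False
    then have "x \<bullet> u i = 0" using assms(2) \<open>i \<le> d\<close> by simp
    then show ?thesis
      by (simp add: u_def inner_diff_right inner_q_face_orth[OF assms(1)])
  qed
qed

text \<open>By \<open>u_total\<close>, x expands in the vectors \<open>\<mu> i *\<^sub>R p i\<close>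
  dual to the \<open>u i\<close>. Taking the inner product with x leaves only terms containing some
  \<open>x \<bullet> p i\<close>.\<close>

lemma p_total:
  assumes x: "x \<in> face_orth" and 0: "\<And>i. i \<in> {k<..d} \<Longrightarrow> x \<bullet> p i = 0"
  shows "x = 0"
proof -
  have "x = (\<Sum>i\<in>{k<..d}. (x \<bullet> u i) *\<^sub>R \<mu> i *\<^sub>R p i)"
  proof (rule biorthogonal_expansion[OF _ _ subspace_face_orth _ u_total x])
    fix i j assume "i \<in> {k<..d}" "j \<in> {k<..d}"
    then show "\<mu> i *\<^sub>R p i \<bullet> u j = (if i = j then 1 else 0)"
      using inner_u_dual[of j i] by (simp add: inner_commute)
  qed (auto simp: p_in_face_orth subspace_face_orth subspace_mul)
  then have "x \<bullet> x = (\<Sum>i\<in>{k<..d}. (x \<bullet> u i) * (\<mu> i * (x \<bullet> p i)))"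
    by (metis (no_types, lifting) inner_scaleR_right inner_sum_right sum.cong)
  also have "\<dots> = 0"
    using 0 by (intro sum.neutral) auto
  finally show ?thesis by simp
qed

text \<open>By \<open>bary_add\<close>, \<open>\<mu> i * (y \<bullet> p i)\<close> is the rate of
  change of \<open>bary i\<close> in direction y. So y is orthogonal to the face and decreases no
  coordinate that vanishes on it.\<close>

definition tangent_part :: "'a set" where
  "tangent_part = {y \<in> face_orth. \<forall>i\<in>{k<..d}. 0 \<le> \<mu> i * (y \<bullet> p i)}"

text \<open>The polar, within \<open>face_orth\<close>, of the cone spanned by the
  \<open>u i\<close>.\<close>

definition normal_part :: "'a set" where
  "normal_part = {y \<in> face_orth. \<forall>i\<in>{k<..d}. y \<bullet> u i \<le> 0}"

section \<open>The tangential and the normal part as orthocentric cones\<close>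

lemma image_shift: "(\<lambda>i. f (k + i)) ` {1..d - k} = f ` {k<..d}"
proof -
  have "(+) k ` {1..d - k} = {k<..d}"
    using k_less by (simp add: image_add_atLeastAtMost atLeastSucAtMost_greaterThanAtMost)
  then show ?thesis by (metis image_image)
qed

text \<open>Orthocentric cones number their generators from 1, the vertices off the face start at k
  + 1. The dual family \<open>b\<close> serves only to certify injectivity and independence of the
  generators.\<close>

lemma orthocentric_cone_if_dual:
  assumes "l0 \<noteq> 0" "\<And>i. i \<in> {k<..d} \<Longrightarrow> l i \<noteq> 0 \<and> (e i = 1 \<or> e i = -1)"
    and ab: "\<And>i j. i \<in> {k<..d} \<Longrightarrow> j \<in> {k<..d} \<Longrightarrow> a i \<bullet> b j = (if i = j then 1 else 0)"
    and "\<And>i j. i \<in> {k<..d} \<Longrightarrow> j \<in> {k<..d} \<Longrightarrow>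
      a i \<bullet> a j = 1 / l0 + (if i = j then 1 / l i else 0)"
    and "C = convex_cone hull ((\<lambda>i. e i *\<^sub>R a i) ` {k<..d})"
  shows "orthocentric_cone (d - k) l0 (\<lambda>i. l (k + i)) (\<lambda>i. e (k + i)) (C :: 'a set)"
  unfolding orthocentric_cone_def
proof (intro conjI exI[of _ "\<lambda>i. a (k + i)"])
  have shift: "k + i \<in> {k<..d}" if "i \<in> {1..d - k}" for i
    using that k_less by auto
  show "inj_on (\<lambda>i. a (k + i)) {1..d - k}"
    by (rule biorthogonal_independent(1)[where b = "\<lambda>i. b (k + i)"]) (auto simp: ab)
  show "independent ((\<lambda>i. a (k + i)) ` {1..d - k})"
    unfolding image_shift[of a] by (rule biorthogonal_independent(2)[OF finite_greaterThanAtMost ab])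
  show "C = convex_cone hull ((\<lambda>i. e (k + i) *\<^sub>R a (k + i)) ` {1..d - k})"
    unfolding image_shift[of "\<lambda>i. e i *\<^sub>R a i"] by (rule assms)
  show "\<forall>i\<in>{1..d - k}. l (k + i) \<noteq> 0 \<and> (e (k + i) = 1 \<or> e (k + i) = -1)"
  proof
    show "l (k + i) \<noteq> 0 \<and> (e (k + i) = 1 \<or> e (k + i) = -1)" if "i \<in> {1..d - k}" for i
      by (rule assms(2)[OF shift[OF that]])
  qed
  show "\<forall>i\<in>{1..d - k}. \<forall>j\<in>{1..d - k}.
      a (k + i) \<bullet> a (k + j) = 1 / l0 + (if i = j then 1 / l (k + i) else 0)"
    using assms(4)[OF shift shift] by simp
qed (rule assms)

lemma tangent_part_eq: "tangent_part = convex_cone hull (u ` {k<..d})"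
proof -
  have total: "x = 0" if x: "x \<in> face_orth" "\<And>i. i \<in> {k<..d} \<Longrightarrow> x \<bullet> (\<mu> i *\<^sub>R p i) = 0" for x
  proof (rule p_total[OF x(1)])
    show "x \<bullet> p i = 0" if "i \<in> {k<..d}" for i
      using x(2)[OF that] \<mu>_nonzero[of i] that by simp
  qed
  have "convex_cone hull (u ` {k<..d}) = {x \<in> face_orth. \<forall>i\<in>{k<..d}. 0 \<le> x \<bullet> (\<mu> i *\<^sub>R p i)}"
    by (rule biorthogonal_convex_cone_hull[OF finite_greaterThanAtMost inner_u_dual subspace_face_orth u_in_face_orth total])
  then show ?thesis
    by (simp add: tangent_part_def)
qed

lemma orthocentric_cone_tangent_part:
  "orthocentric_cone (d - k) \<mu>_face (\<lambda>i. \<mu> (k + i)) (\<lambda>i. 1) tangent_part"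
  by (rule orthocentric_cone_if_dual[where e = "\<lambda>_. 1" and a = u and b = "\<lambda>i. \<mu> i *\<^sub>R p i"])
    (use \<mu>_face_nonzero \<mu>_nonzero inner_u_dual inner_u_u tangent_part_eq in simp_all)

lemma orthocentric_cone_normal_part:
  "orthocentric_cone (d - k) (1 / c) (\<lambda>i. \<mu> (k + i)) (\<lambda>i. sgn (\<mu> (k + i))) normal_part"
proof (rule orthocentric_cone_if_dual[where e = "\<lambda>i. sgn (\<mu> i)" and a = "\<lambda>i. - p i" and b = "\<lambda>i. - \<mu> i *\<^sub>R u i"])
  fix i j assume ij: "i \<in> {k<..d}" "j \<in> {k<..d}"
  then show "- p i \<bullet> (- \<mu> j *\<^sub>R u j) = (if i = j then 1 else 0)"
    using inner_u_p[of j i] \<mu>_nonzero[of j] by (simp add: inner_commute[of "p i"])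
  show "- p i \<bullet> - p j = 1 / (1 / c) + (if i = j then 1 / \<mu> i else 0)"
    using ij by (simp add: inner_p)
next
  \<comment> \<open>The vector dual to \<open>- p i\<close> is a multiple of \<open>u i\<close>
    whose sign depends on \<open>\<mu> i\<close>. With the factor \<open>sgn (\<mu> i)\<close> on
    the generator, the dual vector is a negative multiple of \<open>u i\<close> in all cases, so the
    inequalities become those of \<open>normal_part\<close>.\<close>
  have 1: "(sgn (\<mu> i) *\<^sub>R (- p i)) \<bullet> (- \<bar>\<mu> j\<bar> *\<^sub>R u j) = (if i = j then 1 else 0)"
    if "i \<in> {k<..d}" "j \<in> {k<..d}" for i j
    using inner_u_p[of j i] that \<mu>_nonzero[of i]
    by (cases "\<mu> i" "0 :: real" rule: linorder_cases) (auto simp: inner_commute[of "p i"])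
  have in_face_orth: "sgn (\<mu> i) *\<^sub>R (- p i) \<in> face_orth" if "i \<in> {k<..d}" for i
    using that by (intro subspace_mul subspace_neg subspace_face_orth p_in_face_orth)
  have total: "x = 0" if x: "x \<in> face_orth" "\<And>i. i \<in> {k<..d} \<Longrightarrow> x \<bullet> (- \<bar>\<mu> i\<bar> *\<^sub>R u i) = 0" for x
  proof (rule u_total[OF x(1)])
    show "x \<bullet> u i = 0" if "i \<in> {k<..d}" for i
      using x(2)[OF that] \<mu>_nonzero[of i] that by simp
  qed
  have hull: "convex_cone hull ((\<lambda>i. sgn (\<mu> i) *\<^sub>R (- p i)) ` {k<..d})
      = {x \<in> face_orth. \<forall>i\<in>{k<..d}. 0 \<le> x \<bullet> (- \<bar>\<mu> i\<bar> *\<^sub>R u i)}"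
    by (rule biorthogonal_convex_cone_hull[OF finite_greaterThanAtMost 1 subspace_face_orth in_face_orth total])
  have iff: "0 \<le> x \<bullet> (- \<bar>\<mu> i\<bar> *\<^sub>R u i) \<longleftrightarrow> x \<bullet> u i \<le> 0" if "i \<in> {k<..d}" for i x
    using \<mu>_nonzero[of i] that by (auto simp: mult_le_0_iff)
  show "normal_part = convex_cone hull ((\<lambda>i. sgn (\<mu> i) *\<^sub>R (- p i)) ` {k<..d})"
    unfolding normal_part_def hull using iff by blast
qed (auto simp: c_nonzero \<mu>_nonzero sgn_real_def)

lemma convex_cone_tangent_part: "convex_cone tangent_part"
  by (simp only: tangent_part_eq convex_cone_convex_cone_hull)

text \<open>Along a line inside the cone each defining functional is affine in t and nonnegative,
  hence constant. The direction is then orthogonal to every \<open>p i\<close> with i > k, and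
  \<open>p_total\<close> applies.\<close>

lemma pointed_tangent_part: "pointed tangent_part"
  unfolding pointed_def
proof safe
  fix a b assume "b \<noteq> 0" and ab: "\<forall>t. a + t *\<^sub>R b \<in> tangent_part"
  have "b = 0"
  proof (rule p_total)
    have "a \<in> face_orth" "a + b \<in> face_orth"
      using ab[rule_format, of 0] ab[rule_format, of 1] by (auto simp: tangent_part_def)
    then show "b \<in> face_orth"
      using subspace_diff[OF subspace_face_orth, of "a + b" a] by simp
    fix i assume i: "i \<in> {k<..d}"
    define r s where "r = \<mu> i * (a \<bullet> p i)" and "s = \<mu> i * (b \<bullet> p i)"
    have nonneg: "0 \<le> r + t * s" for t
    proof -
      have "0 \<le> \<mu> i * ((a + t *\<^sub>R b) \<bullet> p i)"
        using ab[rule_format, of t] i unfolding tangent_part_def by blast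
      then show ?thesis
        by (simp add: r_def s_def inner_add_left distrib_left mult.left_commute)
    qed
    have "s = 0"
    proof (rule ccontr)
      assume "s \<noteq> 0"
      \<comment> \<open>At this t the value \<open>r + t * s\<close> is -1.\<close>
      then show False
        using nonneg[of "- (r + 1) / s"] by simp
    qed
    then have "\<mu> i * (b \<bullet> p i) = 0"
      by (simp only: s_def)
    then show "b \<bullet> p i = 0"
      using \<mu>_nonzero[of i] i by simp
  qed
  with \<open>b \<noteq> 0\<close> show False by blast
qed

section \<open>The lineality space and the relative interior of the face\<close>

abbreviation face :: "'a set" where
  "face \<equiv> convex hull (v ` {..k})"

lemma lineality_space_eq: "lineality_space face = span ((\<lambda>i. v i - v 0) ` {..k})"
proof -
  have v0: "v 0 \<in> affine hull face"
    by (intro hull_inc) auto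
  have "(\<lambda>x. - v 0 + x) ` v ` {..k} = (\<lambda>i. v i - v 0) ` {..k}"
    by (simp add: image_image)
  then have "affine hull face = (+) (v 0) ` span ((\<lambda>i. v i - v 0) ` {..k})"
    using affine_hull_span_gen[of "v 0" "v ` {..k}"] v0 by (simp only: affine_hull_convex_hull)
  then show ?thesis
    unfolding lineality_space_eq_translation[OF v0] by (simp only: image_image) simp
qed

lemma face_orth_iff: "y \<in> face_orth \<longleftrightarrow> (\<forall>x\<in>lineality_space face. x \<bullet> y = 0)"
proof
  assume y: "y \<in> face_orth"
  show "\<forall>x\<in>lineality_space face. x \<bullet> y = 0"
  proof
    fix x assume "x \<in> lineality_space face"
    then show "x \<bullet> y = 0"
      unfolding lineality_space_eq
    proof (induction rule: span_induct)
      case base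
      show ?case by (simp add: subspace_def inner_add_left)
    next
      case (step x)
      then show ?case
        using y by (auto simp: face_orth_def vertex_diff_eq inner_commute[of _ y])
    qed
  qed
next
  assume *: "\<forall>x\<in>lineality_space face. x \<bullet> y = 0"
  have "(v i - v 0) \<bullet> y = 0" if "i \<le> k" for i
    using that by (intro *[rule_format]) (auto simp: lineality_space_eq intro: span_base)
  then show "y \<in> face_orth"
    by (simp add: face_orth_def vertex_diff_eq inner_commute[of y])
qed

text \<open>Relative interior points of a simplex are the strictly positive convex combinations of
  its vertices, and \<open>bary_sum_v\<close> identifies the coefficients. These signs are all that
  is used about \<open>x0\<close> below.\<close>

lemma bary_rel_interior_face:
  assumes "\<not> affine_dependent (v ` {..d})" "inj_on v {..d}" "x0 \<in> rel_interior face"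
  shows "\<And>i. i \<le> k \<Longrightarrow> bary i x0 > 0" "\<And>i. i \<in> {k<..d} \<Longrightarrow> bary i x0 = 0"
proof -
  have inj: "inj_on v {..k}"
    using assms(2) k_less by (auto intro: inj_on_subset)
  have "\<not> affine_dependent (v ` {..k})"
    using k_less by (intro affine_independent_subset[OF assms(1)]) auto
  then obtain b where b: "\<forall>x\<in>v ` {..k}. 0 < b x" "sum b (v ` {..k}) = 1"
    "(\<Sum>x\<in>v ` {..k}. b x *\<^sub>R x) = x0"
    using assms(3) by (auto simp: rel_interior_convex_hull_explicit)
  have bary: "bary i x0 = (if i \<le> k then b (v i) else 0)" if "i \<le> d" for i
    using bary_sum_v[of "{..k}" "\<lambda>i. b (v i)" i] b(2,3) k_less that
    by (simp add: sum.reindex[OF inj])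
  show "\<And>i. i \<le> k \<Longrightarrow> bary i x0 > 0" "\<And>i. i \<in> {k<..d} \<Longrightarrow> bary i x0 = 0"
    using b(1) bary k_less by auto
qed

section \<open>The two cones at a point in the relative interior of the face\<close>

context
  fixes x0 :: 'a
  assumes pos: "\<And>i. i \<le> k \<Longrightarrow> bary i x0 > 0" and zero: "\<And>i. i \<in> {k<..d} \<Longrightarrow> bary i x0 = 0"
begin

text \<open>Coordinates that are positive at \<open>x0\<close> survive a short step in any
  direction, so only those vanishing at \<open>x0\<close> restrict y.\<close>

lemma tangent_cone_iff:
  "y \<in> tangent_cone x0 (convex hull (v ` {..d})) \<longleftrightarrow> (\<forall>i\<in>{k<..d}. 0 \<le> \<mu> i * (y \<bullet> p i))"
proof
  assume "y \<in> tangent_cone x0 (convex hull (v ` {..d}))"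
  then obtain t where "t > 0" "\<forall>i\<le>d. 0 \<le> bary i x0 + t * (\<mu> i * (y \<bullet> p i))"
    by (auto simp: tangent_cone_def convex_hull_eq bary_add)
  then show "\<forall>i\<in>{k<..d}. 0 \<le> \<mu> i * (y \<bullet> p i)"
    using zero by (metis add_0 greaterThanAtMost_iff mult_pos_neg not_le)
next
  assume y: "\<forall>i\<in>{k<..d}. 0 \<le> \<mu> i * (y \<bullet> p i)"
  \<comment> \<open>\<open>s i\<close> is a step length that keeps coordinate i nonnegative; the
    added 1 makes the denominator positive. For i > k the coordinate never decreases along y, so any
    positive value would do.\<close>
  define s where "s i = (if i \<le> k then bary i x0 / (1 + \<bar>\<mu> i * (y \<bullet> p i)\<bar>) else 1)" for i
  define t where "t = Min (s ` {..d})"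
  have "0 < s i" if "i \<le> d" for i
    using pos by (auto simp: s_def intro!: divide_pos_pos)
  then have t: "t > 0" unfolding t_def by auto
  have "0 \<le> bary i x0 + t * (\<mu> i * (y \<bullet> p i))" if i: "i \<le> d" for i
  proof (cases "i \<le> k")
    case True
    have "t \<le> bary i x0 / (1 + \<bar>\<mu> i * (y \<bullet> p i)\<bar>)"
      using i True unfolding t_def by (intro Min_le) (auto simp: s_def intro!: image_eqI[of _ _ i])
    then have "t * (1 + \<bar>\<mu> i * (y \<bullet> p i)\<bar>) \<le> bary i x0"
      by (simp add: pos_le_divide_eq add_pos_nonneg)
    moreover have "- (t * (\<mu> i * (y \<bullet> p i))) \<le> t * \<bar>\<mu> i * (y \<bullet> p i)\<bar>"
      using t by (metis abs_ge_minus_self abs_mult abs_of_pos)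
    ultimately show ?thesis
      using t by (simp add: distrib_left)
  next
    case False
    then show ?thesis using i y t zero by simp
  qed
  then show "y \<in> tangent_cone x0 (convex hull (v ` {..d}))"
    using t by (auto simp: tangent_cone_def convex_hull_eq bary_add)
qed

text \<open>Each \<open>p i\<close> with i > k is orthogonal to the lineality space, so the
  inequalities of \<open>tangent_cone_iff\<close> depend only on the component of the direction in
  \<open>face_orth\<close>.\<close>

lemma tangent_cone_eq:
  "tangent_cone x0 (convex hull (v ` {..d})) = {x + y | x y. x \<in> lineality_space face \<and> y \<in> tangent_part}"
proof -
  have L: "x \<bullet> p i = 0" if "x \<in> lineality_space face" "i \<in> {k<..d}" for x i
    using that face_orth_iff p_in_face_orth by blast
  show ?thesis
  proof
    show "{x + y | x y. x \<in> lineality_space face \<and> y \<in> tangent_part} \<subseteq> tangent_cone x0 (convex hull (v ` {..d}))"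
      by (auto simp: tangent_cone_iff tangent_part_def inner_add_left L)
    show "tangent_cone x0 (convex hull (v ` {..d})) \<subseteq> {x + y | x y. x \<in> lineality_space face \<and> y \<in> tangent_part}"
    proof
      fix z assume z: "z \<in> tangent_cone x0 (convex hull (v ` {..d}))"
      obtain x y where xy: "x \<in> lineality_space face" "\<And>a. a \<in> lineality_space face \<Longrightarrow> orthogonal y a" "z = x + y"
        using orthogonal_subspace_decomp_exists[of "(\<lambda>i. v i - v 0) ` {..k}" z]
        unfolding lineality_space_eq by blast
      then have "y \<in> face_orth"
        by (simp add: face_orth_iff orthogonal_def inner_commute)
      moreover have "y \<bullet> p i = z \<bullet> p i" if "i \<in> {k<..d}" for i
        using L[OF xy(1) that] by (simp add: xy(3) inner_add_left)
      ultimately have "y \<in> tangent_part"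
        using z by (simp add: tangent_part_def tangent_cone_iff)
      then show "z \<in> {x + y | x y. x \<in> lineality_space face \<and> y \<in> tangent_part}"
        using xy by blast
    qed
  qed
qed

lemma normal_cone_eq: "normal_cone x0 (convex hull (v ` {..d})) = normal_part"
proof -
  have sum_split: "(\<Sum>i\<le>d. bary i x0 * g i) = (\<Sum>i\<le>k. bary i x0 * g i)" for g :: "nat \<Rightarrow> real"
    using k_less zero by (intro sum.mono_neutral_right) auto
  have sum0: "(\<Sum>i\<le>k. bary i x0) = 1"
    using sum_split[of "\<lambda>_. 1"] sum_bary[of x0] by simp
  \<comment> \<open>Writing z in barycentric coordinates reduces the normal cone condition to the
    vertices.\<close>
  have inner_diff: "y \<bullet> (z - x0) = (\<Sum>i\<le>d. bary i z * (y \<bullet> (v i - x0)))" for y z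
  proof -
    have "(\<Sum>i\<le>d. bary i z * (y \<bullet> (v i - x0))) = y \<bullet> (\<Sum>i\<le>d. bary i z *\<^sub>R v i) - (\<Sum>i\<le>d. bary i z) * (y \<bullet> x0)"
      by (simp only: inner_diff_right right_diff_distrib sum_subtractf inner_sum_right inner_scaleR_right sum_distrib_right)
    also have "\<dots> = y \<bullet> (z - x0)"
      unfolding bary_v sum_bary by (simp add: inner_diff_right)
    finally show ?thesis ..
  qed
  have x0_sum: "(\<Sum>i\<le>k. bary i x0 * (y \<bullet> (v i - x0))) = 0" for y
    unfolding sum_split[symmetric] inner_diff[symmetric] by simp
  \<comment> \<open>On \<open>face_orth\<close> the numbers \<open>y \<bullet> (v i - x0)\<close>
    with i \<le> k all agree, and their weighted mean is 0 by \<open>x0_sum\<close>. So they vanish,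
    and \<open>v 0\<close> may replace \<open>x0\<close>.\<close>
  have inner_vertex: "y \<bullet> (v i - x0) = y \<bullet> p i - y \<bullet> p 0" if "y \<in> face_orth" for y i
  proof -
    have "(\<Sum>i\<le>k. bary i x0 * (y \<bullet> (v i - x0))) = (\<Sum>i\<le>k. bary i x0 * (y \<bullet> (v 0 - x0)))"
    proof (rule sum.cong)
      fix i assume "i \<in> {..k}"
      then have "y \<bullet> p i = y \<bullet> p 0" using face_orth_D[OF that] by blast
      then show "bary i x0 * (y \<bullet> (v i - x0)) = bary i x0 * (y \<bullet> (v 0 - x0))"
        by (simp add: p_def inner_diff_right)
    qed simp
    also have "\<dots> = y \<bullet> (v 0 - x0)"
      by (simp add: sum0 flip: sum_distrib_right)
    finally have "y \<bullet> (v 0 - x0) = 0"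
      by (simp only: x0_sum)
    then show ?thesis
      by (simp add: p_def inner_diff_right)
  qed
  have inner_u: "y \<bullet> (v i - x0) = y \<bullet> u i" if "y \<in> face_orth" for y i
    unfolding inner_vertex[OF that] u_def inner_diff_right[of y "p i"] inner_q_face_orth[OF that] ..
  show ?thesis
  proof safe
    fix y assume "y \<in> normal_cone x0 (convex hull (v ` {..d}))"
    then have y: "y \<bullet> (v i - x0) \<le> 0" if "i \<le> d" for i
      using that hull_inc[of "v i" "v ` {..d}" convex] unfolding normal_cone_def by blast
    \<comment> \<open>Nonnegative terms with sum 0 vanish. As the weights are positive, y is
      constant on the face, which places it in \<open>face_orth\<close>.\<close>
    have "(\<Sum>i\<le>k. - (bary i x0 * (y \<bullet> (v i - x0)))) = 0"
      unfolding sum_negf x0_sum by simp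
    moreover have "0 \<le> - (bary i x0 * (y \<bullet> (v i - x0)))" if "i \<in> {..k}" for i
      using y[of i] pos[of i] that k_less by (simp add: mult_nonneg_nonpos)
    ultimately have "\<forall>i\<in>{..k}. - (bary i x0 * (y \<bullet> (v i - x0))) = 0"
      by (simp only: sum_nonneg_eq_0_iff[OF finite_atMost])
    then have 0: "bary i x0 * (y \<bullet> (v i - x0)) = 0" if "i \<le> k" for i
      using that by simp
    have eq: "y \<bullet> v i = y \<bullet> x0" if "i \<le> k" for i
      using 0[of i] pos[OF that] that by (simp add: inner_diff_right)
    have "y \<in> face_orth"
    proof (rule face_orth_I)
      fix i assume "i \<le> k"
      then show "y \<bullet> p i = y \<bullet> p 0"
        using eq[of i] eq[of 0] by (simp add: p_def inner_diff_right)
    qed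
    then show "y \<in> normal_part"
      unfolding normal_part_def using y by (simp flip: inner_u)
  next
    fix y assume y: "y \<in> normal_part"
    then have "y \<in> face_orth" by (simp add: normal_part_def)
    have "y \<bullet> (z - x0) \<le> 0" if "z \<in> convex hull (v ` {..d})" for z
      unfolding inner_diff[of y z]
    proof (intro sum_nonpos mult_nonneg_nonpos)
      fix i assume "i \<in> {..d}"
      then show "0 \<le> bary i z" using that by (simp add: convex_hull_eq)
      show "y \<bullet> (v i - x0) \<le> 0"
      proof (cases "i \<le> k")
        case True
        then have "y \<bullet> p i = y \<bullet> p 0" by (rule face_orth_D[OF \<open>y \<in> face_orth\<close>])
        then show ?thesis unfolding inner_vertex[OF \<open>y \<in> face_orth\<close>] by simp
      next
        case False
        then show ?thesis unfolding inner_u[OF \<open>y \<in> face_orth\<close>] using y \<open>i \<in> {..d}\<close> by (simp add: normal_part_def)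
      qed
    qed
    then show "y \<in> normal_cone x0 (convex hull (v ` {..d}))"
      by (simp add: normal_cone_def)
  qed
qed

end

end

theorem theorem4p4:
  fixes v :: "nat \<Rightarrow> 'a::euclidean_space" and w x0 :: 'a and d k :: nat and S F :: "'a set"
  assumes "d = DIM('a)" and "d \<ge> 2"
    and "inj_on v {..d}" and "\<not> affine_dependent (v ` {..d})"
    and "S = convex hull (v ` {..d})"
    and "is_orthocenter v d w"
    and "w \<in> rel_interior S \<or> w \<in> affine hull S - S"
    and "k < d"
    and "F = convex hull (v ` {..k})"
    and "x0 \<in> rel_interior F"
    and "DIM('b::euclidean_space) \<ge> d - k"
  shows "\<exists>c. c \<noteq> 0 \<and>
    (\<forall>i\<le>d. \<forall>j\<le>d. i \<noteq> j \<longrightarrow> (v i - w) \<bullet> (v j - w) = c) \<and>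
    (\<forall>i\<le>d. (norm (v i - w))\<^sup>2 - c \<noteq> 0) \<and>
    (let \<mu> = (\<lambda>i. 1 / ((norm (v i - w))\<^sup>2 - c)); L = lineality_space F in
      (\<exists>D. subspace L \<and> dim L = k \<and> convex_cone D \<and> pointed D \<and>
          (\<forall>x\<in>L. \<forall>y\<in>D. x \<bullet> y = 0) \<and>
          tangent_cone x0 S = {x + y | x y. x \<in> L \<and> y \<in> D} \<and>
          - 1 / c - (\<Sum>i=k+1..d. \<mu> i) = (\<Sum>i=0..k. \<mu> i) \<and>
          isometric_to_orthocentric_cone TYPE('b) D (d - k)
            (- 1 / c - (\<Sum>i=k+1..d. \<mu> i)) (\<lambda>i. \<mu> (k + i)) (\<lambda>i. 1) \<and>
          isometric_to_orthocentric_cone TYPE('b) D (d - k)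
            (\<Sum>i=0..k. \<mu> i) (\<lambda>i. \<mu> (k + i)) (\<lambda>i. 1)) \<and>
      1 / c = - (\<Sum>i=0..d. \<mu> i) \<and>
      isometric_to_orthocentric_cone TYPE('b) (normal_cone x0 S) (d - k)
        (1 / c) (\<lambda>i. \<mu> (k + i)) (\<lambda>i. sgn (\<mu> (k + i))) \<and>
      isometric_to_orthocentric_cone TYPE('b) (normal_cone x0 S) (d - k)
        (- (\<Sum>i=0..d. \<mu> i)) (\<lambda>i. \<mu> (k + i)) (\<lambda>i. sgn (\<mu> (k + i))))"
proof -
  note S = assms(5) and F = assms(9)
  have UNIV: "affine hull (v ` {..d}) = UNIV"
  proof -
    have "aff_dim (v ` {..d}) = int (card (v ` {..d})) - 1"
      using aff_dim_affine_independent[OF assms(4)] by simp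
    also have "\<dots> = int DIM('a)"
      using assms(1,3) by (simp add: card_image)
    finally show ?thesis
      by (rule aff_dim_eq_full[THEN iffD1])
  qed
  obtain c where inner_eq: "\<And>i j. i \<le> d \<Longrightarrow> j \<le> d \<Longrightarrow> i \<noteq> j \<Longrightarrow> (v i - w) \<bullet> (v j - w) = c"
    using orthocenter_inner_eq[OF assms(6,2)] by metis
  \<comment> \<open>A vertex is an extreme point of S. It belongs to S, and it is not in the
    relative interior because S has more than one point, so both alternatives for w exclude
    it.\<close>
  have not_vertex: "w \<noteq> v i" if "i \<le> d" for i
  proof
    assume w: "w = v i"
    then have "w extreme_point_of S"
      using that by (simp add: S extreme_point_of_convex_hull_affine_independent[OF assms(4)])
    moreover have "S \<noteq> {w}"
    proof
      assume "S = {w}"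
      then have "v i = w" if "i \<le> d" for i
        using that hull_inc[of "v i" "v ` {..d}" convex] by (simp add: S)
      then have "v 0 = v 1"
        using assms(2) by simp
      then show False
        using inj_onD[OF assms(3), of 0 1] assms(2) by simp
    qed
    ultimately show False
      using assms(7) extreme_point_not_in_REL_INTERIOR[of w S] unfolding extreme_point_of_def by blast
  qed
  have "c \<noteq> 0"
  proof
    assume c: "c = 0"
    have inj: "inj_on (\<lambda>i. v i - w) {..d}"
      using assms(3) by (auto simp: inj_on_def)
    have "independent ((\<lambda>i. v i - w) ` {..d})"
    proof (rule pairwise_orthogonal_independent)
      show "pairwise orthogonal ((\<lambda>i. v i - w) ` {..d})"
      proof (rule pairwiseI)
        fix x y assume "x \<in> (\<lambda>i. v i - w) ` {..d}" "y \<in> (\<lambda>i. v i - w) ` {..d}" "x \<noteq> y"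
        then obtain i j where "i \<le> d" "j \<le> d" "i \<noteq> j" "x = v i - w" "y = v j - w" by blast
        then show "orthogonal x y"
          using inner_eq[of i j] c by (simp add: orthogonal_def)
      qed
      show "0 \<notin> (\<lambda>i. v i - w) ` {..d}"
      proof
        assume "0 \<in> (\<lambda>i. v i - w) ` {..d}"
        then obtain i where "i \<le> d" "v i - w = 0" by fastforce
        then show False
          using not_vertex[of i] by simp
      qed
    qed
    \<comment> \<open>There are d + 1 of these independent vectors in a space of dimension
      d.\<close>
    then have "card ((\<lambda>i. v i - w) ` {..d}) \<le> DIM('a)"
      by (rule independent_card_le)
    then show False
      unfolding card_image[OF inj] using assms(1) by simp
  qed
  interpret orthocentric_simplex_face v d w c k
    using UNIV inner_eq \<open>c \<noteq> 0\<close> assms(8) by unfold_locales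
  have pos: "\<And>i. i \<le> k \<Longrightarrow> bary i x0 > 0" and zero: "\<And>i. i \<in> {k<..d} \<Longrightarrow> bary i x0 = 0"
    using bary_rel_interior_face[OF assms(4,3)] assms(10) F by auto
  \<comment> \<open>The sum over 0, ..., d splits at k, which identifies the two forms of the
    parameter \<lambda>_0 for each cone.\<close>
  have sums: "1 / c = - (\<Sum>i=0..d. \<mu> i)" "- 1 / c - (\<Sum>i=k+1..d. \<mu> i) = \<mu>_face" "(\<Sum>i=0..k. \<mu> i) = \<mu>_face"
  proof -
    have "(\<Sum>i\<le>d. \<mu> i) = \<mu>_face + (\<Sum>i=k+1..d. \<mu> i)"
      unfolding \<mu>_face_def using sum.ub_add_nat[of 0 k \<mu> "d - k"] k_less by (simp add: atMost_atLeast0)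
    then show "1 / c = - (\<Sum>i=0..d. \<mu> i)" "- 1 / c - (\<Sum>i=k+1..d. \<mu> i) = \<mu>_face" "(\<Sum>i=0..k. \<mu> i) = \<mu>_face"
      using sum_\<mu> by (simp_all add: atMost_atLeast0 \<mu>_face_def)
  qed
  have \<mu>: "(\<lambda>i. 1 / ((norm (v i - w))\<^sup>2 - c)) = \<mu>"
    by (rule ext) (simp add: \<mu>_def)
  have "aff_dim F = int k"
  proof -
    have "\<not> affine_dependent (v ` {..k})"
      using k_less by (intro affine_independent_subset[OF assms(4)]) auto
    moreover have "inj_on v {..k}"
      using k_less by (intro inj_on_subset[OF assms(3)]) auto
    ultimately show ?thesis
      using aff_dim_affine_independent[of "v ` {..k}"] by (simp add: F card_image aff_dim_convex_hull)
  qed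
  then have dim: "dim (lineality_space F) = k"
    using aff_dim_eq_dim_lineality_space[of F] by (simp add: F)
  have sub: "subspace (lineality_space F)"
    unfolding F lineality_space_eq by (rule subspace_span)
  have orth: "\<forall>x\<in>lineality_space F. \<forall>y\<in>tangent_part. x \<bullet> y = 0"
    using face_orth_iff unfolding F tangent_part_def by blast
  have tangent: "tangent_cone x0 S = {x + y | x y. x \<in> lineality_space F \<and> y \<in> tangent_part}"
    unfolding S F by (rule tangent_cone_eq[OF pos zero])
  have normal: "normal_cone x0 S = normal_part"
    unfolding S by (rule normal_cone_eq[OF pos zero])
  have T: "isometric_to_orthocentric_cone TYPE('b) tangent_part (d - k) \<mu>_face (\<lambda>i. \<mu> (k + i)) (\<lambda>i. 1)"
    by (rule isometric_to_orthocentric_cone_self[OF orthocentric_cone_tangent_part assms(11)])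
  have N: "isometric_to_orthocentric_cone TYPE('b) normal_part (d - k) (1 / c) (\<lambda>i. \<mu> (k + i)) (\<lambda>i. sgn (\<mu> (k + i)))"
    by (rule isometric_to_orthocentric_cone_self[OF orthocentric_cone_normal_part assms(11)])
  \<comment> \<open>After rewriting with \<open>sums\<close>, the two isometry claims for each cone
    coincide, so \<open>T\<close> and \<open>N\<close> each settle both.\<close>
  show ?thesis
    by (rule exI[of _ c], unfold \<mu>, unfold Let_def sums(2,3) sums(1)[symmetric] normal,
        intro conjI exI[of _ tangent_part] allI impI refl \<open>c \<noteq> 0\<close> inner_eq norm_nonzero sub dim
          convex_cone_tangent_part pointed_tangent_part orth tangent T N)
qed

end
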